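(* Let $A^\ast_{n,\ge m}$, $\xi_n$, $\alpha_j$ be taken from any one of the four families (Bernoulli, Cauchy, Euler, Euler of the second kind) described in the context, with the corresponding integer parameter $N$. For integers $n$ and $m$ with $n\ge m\ge 1$, we have $$A_{n,\ge m}^\ast=\xi_n\det(M),$$ where $M=(M_{i,j})_{1\le i,j\le n}$ is the $n\times n$ Toeplitz matrix with $$M_{i,j}=\begin{cases}\alpha_{i-j+1}&\text{if }i-j+1\ge m,\\ 1&\text{if } j=i+1,\\ 0&\text{otherwise.}\end{cases}$$
   Context: $(x)^{(n)}=x(x+1)\cdots(x+n-1)$ for $n\ge1$ and $(x)^{(0)}=1$ (rising factorial). All identities below are between formal power series in $x$. For an integer $m\ge 1$ define the modified associated hypergeometric numbers by: - Bernoulli ($N\ge1$): $\left(1+\sum_{n=m}^{\infty}\frac{x^n}{(N+1)^{(n)}}\right)^{-1}=\sum_{n=0}^\infty B_{N,n,\ge m}^\ast\frac{x^n}{n!}$; - Cauchy ($N\ge1$): $\left(1+N\sum_{n=m}^{\infty}\frac{(-x)^n}{N+n}\right)^{-1}=\sum_{n=0}^\infty c_{N,n,\ge m}^\ast\frac{x^n}{n!}$; - Euler ($N\ge0$): $\left(1+\sum_{n=m}^{\infty}\frac{x^{2n}}{(2N+1)^{(2n)}}\right)^{-1}=\sum_{n=0}^\infty E_{N,n,\ge m}^\ast\frac{x^n}{n!}$; - Euler of the second kind ($N\ge0$): $\left(1+\sum_{n=m}^{\infty}\frac{x^{2n}}{(2N+2)^{(2n)}}\right)^{-1}=\sum_{n=0}^\infty\widehat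 E_{N,n,\ge m}^\ast\frac{x^n}{n!}$. The symbols $A^\ast_{n,\ge m}$, $\xi_n$ ($n\ge0$), $\alpha_j$ ($j\ge1$) denote simultaneously one of the following choices ($N$ is suppressed from the notation): - Bernoulli: $A^\ast_{n,\ge m}=B^\ast_{N,n,\ge m}$, $\xi_n=(-1)^n n!$, $\alpha_j=\frac{N!}{(N+j)!}$, $N\ge1$; - Cauchy: $A^\ast_{n,\ge m}=c^\ast_{N,n,\ge m}$, $\xi_n=n!$, $\alpha_j=\frac{N}{N+j}$, $N\ge1$; - Euler: $A^\ast_{n,\ge m}=E^\ast_{N,2n,\ge m}$, $\xi_n=(-1)^n(2n)!$, $\alpha_j=\frac{(2N)!}{(2N+2j)!}$, $N\ge0$; - Euler of the second kind: $A^\ast_{n,\ge m}=\widehat E^\ast_{N,2n,\ge m}$, $\xi_n=(-1)^n(2n)!$, $\alpha_j=\frac{(2N+1)!}{(2N+2j+1)!}$, $N\ge0$. *)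

theory Defs
  imports
    "HOL-Computational_Algebra.Formal_Power_Series"
    "Jordan_Normal_Form.Determinant"
begin

definition egf_coeff :: "rat fps \<Rightarrow> nat \<Rightarrow> rat" where
  "egf_coeff F n = fact n * fps_nth F n"

lemma egf_expansion: "F = Abs_fps (\<lambda>n. egf_coeff F n / fact n)"
  by (simp add: egf_coeff_def fps_eq_iff)

text \<open>
  In all four series \<open>m\<close> is the index at which the summation starts. The rising
  factorial is \<^const>\<open>pochhammer\<close>. The hypergeometric numbers are meant for
  \<open>m \<ge> 1\<close>, where the series has constant coefficient 1, so that \<^const>\<open>inverse\<close>
  is its multiplicative inverse.
\<close>

definition bernoulli_series :: "nat \<Rightarrow> nat \<Rightarrow> rat fps" where
  "bernoulli_series N m =
     1 + Abs_fps (\<lambda>n. if m \<le> n then 1 / pochhammer (of_nat (N + 1)) n else 0)"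

definition cauchy_series :: "nat \<Rightarrow> nat \<Rightarrow> rat fps" where
  "cauchy_series N m =
     1 + fps_const (of_nat N) *
       Abs_fps (\<lambda>n. if m \<le> n then (- 1) ^ n / of_nat (N + n) else 0)"

text \<open>
  In the two Euler series \<open>k = 2 * n\<close> is the exponent of the variable, and the
  condition \<open>2 * m \<le> k\<close> says \<open>m \<le> n\<close>.
\<close>

definition euler_series :: "nat \<Rightarrow> nat \<Rightarrow> rat fps" where
  "euler_series N m =
     1 + Abs_fps (\<lambda>k. if even k \<and> 2 * m \<le> k
                     then 1 / pochhammer (of_nat (2 * N + 1)) k else 0)"

definition euler2_series :: "nat \<Rightarrow> nat \<Rightarrow> rat fps" where
  "euler2_series N m =
     1 + Abs_fps (\<lambda>k. if even k \<and> 2 * m \<le> k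
                     then 1 / pochhammer (of_nat (2 * N + 2)) k else 0)"

lemma series_mult_inverse:
  assumes "m \<ge> 1"
  shows "bernoulli_series N m * inverse (bernoulli_series N m) = 1"
    and "cauchy_series N m * inverse (cauchy_series N m) = 1"
    and "euler_series N m * inverse (euler_series N m) = 1"
    and "euler2_series N m * inverse (euler2_series N m) = 1"
  using assms
  by (auto intro!: inverse_mult_eq_1' simp: bernoulli_series_def cauchy_series_def
      euler_series_def euler2_series_def)

definition bernoulli_star :: "nat \<Rightarrow> nat \<Rightarrow> nat \<Rightarrow> rat" where
  "bernoulli_star N m n = egf_coeff (inverse (bernoulli_series N m)) n"

definition cauchy_star :: "nat \<Rightarrow> nat \<Rightarrow> nat \<Rightarrow> rat" where
  "cauchy_star N m n = egf_coeff (inverse (cauchy_series N m)) n"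

definition euler_star :: "nat \<Rightarrow> nat \<Rightarrow> nat \<Rightarrow> rat" where
  "euler_star N m n = egf_coeff (inverse (euler_series N m)) n"

definition euler2_star :: "nat \<Rightarrow> nat \<Rightarrow> nat \<Rightarrow> rat" where
  "euler2_star N m n = egf_coeff (inverse (euler2_series N m)) n"

datatype family = Bernoulli | Cauchy | Euler | Euler2

fun admissible :: "family \<Rightarrow> nat \<Rightarrow> bool" where
  "admissible Bernoulli N \<longleftrightarrow> N \<ge> 1"
| "admissible Cauchy N \<longleftrightarrow> N \<ge> 1"
| "admissible Euler N \<longleftrightarrow> True"
| "admissible Euler2 N \<longleftrightarrow> True"

fun A_star :: "family \<Rightarrow> nat \<Rightarrow> nat \<Rightarrow> nat \<Rightarrow> rat" where
  "A_star Bernoulli N m n = bernoulli_star N m n"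
| "A_star Cauchy N m n = cauchy_star N m n"
| "A_star Euler N m n = euler_star N m (2 * n)"
| "A_star Euler2 N m n = euler2_star N m (2 * n)"

fun xi :: "family \<Rightarrow> nat \<Rightarrow> rat" where
  "xi Bernoulli n = (- 1) ^ n * fact n"
| "xi Cauchy n = fact n"
| "xi Euler n = (- 1) ^ n * fact (2 * n)"
| "xi Euler2 n = (- 1) ^ n * fact (2 * n)"

fun alpha :: "family \<Rightarrow> nat \<Rightarrow> nat \<Rightarrow> rat" where
  "alpha Bernoulli N j = fact N / fact (N + j)"
| "alpha Cauchy N j = of_nat N / of_nat (N + j)"
| "alpha Euler N j = fact (2 * N) / fact (2 * N + 2 * j)"
| "alpha Euler2 N j = fact (2 * N + 1) / fact (2 * N + 2 * j + 1)"

text \<open>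
  Matrix indices start at 0 here instead of 1. The entries depend only on \<open>i - j\<close>,
  so the defining conditions are unchanged. The test \<open>m \<le> i - j + 1\<close> is written
  as \<open>m + j \<le> i + 1\<close>, which also ensures that \<open>i + 1 - j\<close> is not truncated.
\<close>

definition toeplitz_mat :: "(nat \<Rightarrow> rat) \<Rightarrow> nat \<Rightarrow> nat \<Rightarrow> rat mat" where
  "toeplitz_mat a m n = mat n n (\<lambda>(i, j).
     if m + j \<le> i + 1 then a (i + 1 - j)
     else if j = i + 1 then 1
     else 0)"

end

theory Submission
  imports Defs
begin

text \<open>
  All four identities are instances of one fact about an invertible power series. Let
  \<open>f\<close> have constant coefficient \<open>1\<close> and inverse \<open>g\<close>, and let \<open>T\<close> be the
  \<open>n \<times> n\<close> Toeplitz matrix with entries \<open>f\<^bsub>i-j+1\<^esub>\<close>, whose superdiagonal therefore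
  consists of ones; then \<open>det T = (-1)\<^sup>n g\<^sub>n\<close> (lemma \<open>det_hessenberg_toeplitz\<close>).

  Multiplying \<open>T\<close> from the left by the unipotent Toeplitz matrix
  \<open>L\<close> with entries \<open>g\<^bsub>i-j\<^esub>\<close> does not change the determinant. The entries
  of \<open>L T\<close> are convolutions of \<open>g\<close> with \<open>f\<close>. From the second column on, the
  convolution is complete and gives a coefficient of \<open>f g = 1\<close>. In the first column the
  term belonging to \<open>f\<^sub>0 = 1\<close> is missing, which leaves \<open>-g\<^bsub>i+1\<^esub>\<close> in row \<open>i\<close>,
  counted from \<open>0\<close>. So the last row of \<open>L T\<close> has the single entry \<open>-g\<^sub>n\<close>,
  and its minor is the identity matrix.

  To reach the hypergeometric numbers, let \<open>h = 1 + \<Sum>\<^bsub>j\<ge>m\<^esub> \<alpha>\<^sub>j x\<^sup>j\<close>. The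
  four defining series are \<open>h(x)\<close> for Bernoulli, \<open>h(-x)\<close> for Cauchy and \<open>h(x\<^sup>2)\<close>
  for the two Euler families. Substitution commutes with inversion, so \<open>A\<^sup>*\<^sub>n\<close> is
  the coefficient of \<open>1/h\<close> at \<open>x\<^sup>n\<close>, up to the factorial and, for Cauchy, the sign
  \<open>(-1)\<^sup>n\<close>. This sign cancels the one in the determinant formula, and that is why
  \<open>\<xi>\<^sub>n\<close> carries no sign in the Cauchy case.
\<close>

section \<open>The coefficients of an inverse power series as Toeplitz determinants\<close>

text \<open>
  This is the shape of the product \<open>L T\<close>. The last row has no superdiagonal entry, so it
  is zero outside the first column; deleting this row and the first column leaves an identity
  matrix.
\<close>

lemma det_first_column_and_superdiagonal:
  fixes c :: "nat \<Rightarrow> 'a :: comm_ring_1"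
  shows "det (mat (Suc p) (Suc p)
           (\<lambda>(i, j). if j = 0 then c i else if j = Suc i then 1 else 0)) = (- 1) ^ p * c p"
    (is "det ?A = _")
proof -
  have "mat_delete ?A p 0 = 1\<^sub>m p"
    by (rule eq_matI) (auto simp: mat_delete_def)
  then have cof: "cofactor ?A p 0 = (- 1) ^ p"
    by (simp add: cofactor_def)
  have "det ?A = (\<Sum>j<Suc p. ?A $$ (p, j) * cofactor ?A p j)"
    by (rule laplace_expansion_row) auto
  also have "\<dots> = (\<Sum>j<Suc p. if j = 0 then c p * cofactor ?A p 0 else 0)"
    by (rule sum.cong) auto
  also have "\<dots> = c p * (- 1) ^ p"
    by (subst sum.delta) (auto simp: cof)
  finally show ?thesis
    by (simp add: mult.commute)
qed

text \<open>
  The superdiagonal entries are \<open>f\<^sub>0 = 1\<close>, and the first column starts one coefficient late, at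
  \<open>f\<^sub>1\<close>. Because of this shift the convolutions with \<open>g\<close> lose their \<open>f\<^sub>0\<close> term in
  the first column, and \<open>g\<close> itself appears there.
\<close>

lemma det_hessenberg_toeplitz:
  fixes f g :: "'a :: comm_ring_1 fps"
  assumes f0: "fps_nth f 0 = 1" and fg: "f * g = 1"
  shows "det (mat n n (\<lambda>(i, j). if j \<le> i + 1 then fps_nth f (i + 1 - j) else 0))
       = (- 1) ^ n * fps_nth g n"
proof (cases n)
  case 0
  have "fps_nth (f * g) 0 = 1"
    by (simp add: fg)
  with 0 f0 show ?thesis
    by simp
next
  case (Suc p)
  define T where "T = mat n n (\<lambda>(i, j). if j \<le> i + 1 then fps_nth f (i + 1 - j) else 0)"
  define L where "L = mat n n (\<lambda>(i, j). if j \<le> i then fps_nth g (i - j) else 0)"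
  have T: "T \<in> carrier_mat n n" and L: "L \<in> carrier_mat n n"
    by (auto simp: T_def L_def)
  have convolution: "(\<Sum>q = 0..k. fps_nth f q * fps_nth g (k - q)) = (if k = 0 then 1 else 0)"
    for k
    using fg by (metis fps_mult_nth fps_one_nth)
  then have g0: "fps_nth g 0 = 1"
    using f0 by (metis fg fps_mult_nth_0 fps_one_nth mult_1)

  have "det L = prod_list (diag_mat L)"
    by (rule det_lower_triangular[OF _ L]) (auto simp: L_def)
  also have "\<dots> = 1"
    using L by (simp add: prod_list_diag_prod) (simp add: L_def g0)
  finally have det_L: "det L = 1" .

  have first_column: "(\<Sum>k = 0..i. fps_nth g (i - k) * fps_nth f (k + 1)) = - fps_nth g (i + 1)"
    for i
  proof -
    have "0 = (\<Sum>q = 0..Suc i. fps_nth f q * fps_nth g (Suc i - q))"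
      by (simp only: convolution) simp
    also have "\<dots> = fps_nth g (Suc i) + (\<Sum>q = 0..i. fps_nth f (Suc q) * fps_nth g (i - q))"
      by (subst sum.atLeast0_atMost_Suc_shift) (simp add: f0)
    finally show ?thesis
      by (simp add: eq_neg_iff_add_eq_0 mult.commute add.commute)
  qed

  have later_columns:
    "(\<Sum>k = r..i. fps_nth g (i - k) * fps_nth f (k - r)) = (if r = i then 1 else 0)" for r i
  proof (cases "r \<le> i")
    case True
    then have "(\<Sum>k = r..i. fps_nth g (i - k) * fps_nth f (k - r))
        = (\<Sum>q = 0..i - r. fps_nth f q * fps_nth g (i - r - q))"
      by (intro sum.reindex_bij_witness[of _ "\<lambda>q. q + r" "\<lambda>k. k - r"])
         (auto simp: mult.commute)
    then show ?thesis
      using True by (simp only: convolution) auto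
  qed auto

  have "L * T = mat n n
      (\<lambda>(i, j). if j = 0 then - fps_nth g (i + 1) else if j = Suc i then 1 else 0)" (is "_ = ?A")
  proof (rule eq_matI)
    fix i j
    assume "i < dim_row ?A" and "j < dim_col ?A"
    then have i: "i < n" and j: "j < n"
      by auto
    have "(L * T) $$ (i, j) = (\<Sum>k = 0..<n. L $$ (i, k) * T $$ (k, j))"
      using i j L T by (auto simp: scalar_prod_def)
    \<comment> \<open>The sum starts at \<open>0\<close> both for \<open>j = 0\<close>, where \<open>j - 1\<close> is truncated, and for
      \<open>j = 1\<close>; only the former omits \<open>f\<^sub>0\<close>.\<close>
    also have "\<dots> = (\<Sum>k = j - 1..i. fps_nth g (i - k) * fps_nth f (k + 1 - j))"
      using i j by (intro sum.mono_neutral_cong_right) (auto simp: L_def T_def)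
    also have "\<dots> = (if j = 0 then - fps_nth g (i + 1) else if j = Suc i then 1 else 0)"
    proof (cases j)
      case 0
      then show ?thesis
        using first_column[of i] by simp
    next
      case (Suc r)
      then show ?thesis
        using later_columns[of i r] by simp
    qed
    finally show "(L * T) $$ (i, j) = ?A $$ (i, j)"
      using i j by simp
  qed (use L T in auto)
  then have "det (L * T) = (- 1) ^ p * - fps_nth g (p + 1)"
    unfolding Suc by (simp only: det_first_column_and_superdiagonal)
  then have "det T = (- 1) ^ n * fps_nth g n"
    using det_mult[OF L T] by (simp add: det_L Suc)
  then show ?thesis
    by (simp add: T_def)
qed

section \<open>The four families as substitutions into one series\<close>

definition gap_series :: "(nat \<Rightarrow> rat) \<Rightarrow> nat \<Rightarrow> rat fps" where
  "gap_series a m = 1 + Abs_fps (\<lambda>j. if m \<le> j then a j else 0)"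

text \<open>
  For \<open>m \<ge> 1\<close> the gap below \<open>m\<close> leaves the constant coefficient \<open>1\<close> untouched. This
  coefficient is the superdiagonal of the matrix, so the separate case \<open>j = i + 1\<close> of its
  definition fits the Toeplitz pattern.
\<close>

lemma det_toeplitz_mat:
  assumes "1 \<le> m"
  shows "det (toeplitz_mat a m n) = (- 1) ^ n * fps_nth (inverse (gap_series a m)) n"
proof -
  have f0: "fps_nth (gap_series a m) 0 = 1"
    using assms by (simp add: gap_series_def)
  then have "gap_series a m * inverse (gap_series a m) = 1"
    by (intro inverse_mult_eq_1') simp
  moreover have "toeplitz_mat a m n = mat n n
      (\<lambda>(i, j). if j \<le> i + 1 then fps_nth (gap_series a m) (i + 1 - j) else 0)"
    using assms by (intro eq_matI) (auto simp: toeplitz_mat_def gap_series_def)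
  ultimately show ?thesis
    using det_hessenberg_toeplitz[OF f0] by simp
qed

lemma inverse_pochhammer_eq_fact_ratio:
  "1 / pochhammer (of_nat (M + 1)) k = (fact M / fact (M + k) :: rat)"
proof -
  have "(fact (M + k) :: rat) = fact M * pochhammer (of_nat (M + 1)) k"
    using pochhammer_product'[of "1 :: rat" M k] by (simp add: pochhammer_fact add.commute)
  then show ?thesis
    by simp
qed

lemma bernoulli_series_eq: "bernoulli_series N m = gap_series (alpha Bernoulli N) m"
  unfolding bernoulli_series_def gap_series_def inverse_pochhammer_eq_fact_ratio by (simp add: fps_eq_iff)

lemma cauchy_series_eq:
  "cauchy_series N m = gap_series (alpha Cauchy N) m oo (fps_const (- 1) * fps_X)"
  unfolding fps_compose_linear
  by (auto simp: fps_eq_iff cauchy_series_def gap_series_def)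

lemma fps_nth_compose_X_square:
  "fps_nth (h oo fps_X ^ 2) k = (if even k then fps_nth h (k div 2) else (0 :: rat))"
proof -
  have "fps_nth (h oo fps_X ^ 2) k = (\<Sum>i = 0..k. if k = 2 * i then fps_nth h i else 0)"
    unfolding fps_compose_nth power_mult[symmetric] by (intro sum.cong) auto
  also have "\<dots> = (\<Sum>i = 0..k. if i = k div 2 then (if even k then fps_nth h i else 0) else 0)"
    by (intro sum.cong) auto
  finally show ?thesis
    by simp
qed

lemma euler_series_eq: "euler_series N m = gap_series (alpha Euler N) m oo fps_X ^ 2"
  unfolding euler_series_def inverse_pochhammer_eq_fact_ratio
  by (auto simp: fps_eq_iff fps_nth_compose_X_square gap_series_def elim!: evenE)

lemma euler2_series_eq: "euler2_series N m = gap_series (alpha Euler2 N) m oo fps_X ^ 2"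
proof -
  have "1 / pochhammer (of_nat (2 * N + 2)) k = (fact (2 * N + 1) / fact (2 * N + 1 + k) :: rat)"
    for k
    using inverse_pochhammer_eq_fact_ratio[of "2 * N + 1" k] by simp
  then show ?thesis
    unfolding euler2_series_def
    by (auto simp: fps_eq_iff fps_nth_compose_X_square gap_series_def elim!: evenE)
qed

theorem proposition3:
  fixes F :: family and N m n :: nat
  assumes "admissible F N" and "1 \<le> m" and "m \<le> n"
  shows "A_star F N m n = xi F n * det (toeplitz_mat (alpha F N) m n)"
proof -
  define h where "h = gap_series (alpha F N) m"
  have h0: "fps_nth h 0 \<noteq> 0"
    using assms by (simp add: h_def gap_series_def)
  have det: "det (toeplitz_mat (alpha F N) m n) = (- 1) ^ n * fps_nth (inverse h) n"
    unfolding h_def using assms by (intro det_toeplitz_mat)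
  have sign: "(- 1) ^ n * ((- 1) ^ n * x) = x" for x :: rat
    by (simp flip: mult.assoc power_mult_distrib)
  have linear: "inverse (h oo (fps_const (- 1) * fps_X)) = inverse h oo (fps_const (- 1) * fps_X)"
    using h0 by (intro fps_inverse_compose[symmetric]) auto
  have square: "fps_nth (inverse (h oo fps_X ^ 2)) (2 * n) = fps_nth (inverse h) n"
    using h0 by (simp add: fps_inverse_compose[symmetric] fps_nth_compose_X_square)
  show ?thesis
  proof (cases F)
    case Bernoulli
    then have "bernoulli_series N m = h"
      by (simp only: h_def bernoulli_series_eq)
    with Bernoulli show ?thesis
      by (simp add: det[unfolded Bernoulli] sign bernoulli_star_def egf_coeff_def)
  next
    case Cauchy
    then have "cauchy_series N m = h oo (fps_const (- 1) * fps_X)"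
      by (simp only: h_def cauchy_series_eq)
    then have "inverse (cauchy_series N m) = Abs_fps (\<lambda>k. (- 1) ^ k * fps_nth (inverse h) k)"
      by (simp only: linear) (simp only: fps_compose_linear)
    with Cauchy show ?thesis
      by (simp add: det[unfolded Cauchy] cauchy_star_def egf_coeff_def)
  next
    case Euler
    then have "euler_series N m = h oo fps_X ^ 2"
      by (simp only: h_def euler_series_eq)
    with Euler show ?thesis
      by (simp add: det[unfolded Euler] sign euler_star_def egf_coeff_def square)
  next
    case Euler2
    then have "euler2_series N m = h oo fps_X ^ 2"
      by (simp only: h_def euler2_series_eq)
    with Euler2 show ?thesis
      by (simp add: det[unfolded Euler2] sign euler2_star_def egf_coeff_def square)
  qed
qed

end
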